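(* Let $\alpha=1$, let $\beta_2\in[-1,1]$, and let $Z_1,Z_2$ be independent standard normal random variables. Then for every $x\in(-\infty,\infty)$ the function $\mathbf 1\{G_1(Z_1,Z_2)\le x\}$ has Hermite rank $m(x)=1$, and its Hermite coefficients of total degree one are as follows. (a) If $\beta_2=0$, $$J_{1,0}(x,0)=-(\phi\circ\Phi^{-1})\!\left[\tfrac1\pi\left(\arctan\left(\tfrac2\pi x\right)+\tfrac\pi2\right)\right],\qquad J_{0,1}(x,0)=0 .$$ (b) If $\beta_2>0$, $$J_{1,0}(x,\beta_2)=\frac1\pi\int_{-\pi/2}^{\pi/2}\exp\{-e^{-x/\beta_2}a_1(\gamma)\}\,\Phi^{-1}\!\left(\tfrac1\pi\left(\gamma+\tfrac\pi2\right)\right)d\gamma,$$ $$J_{0,1}(x,\beta_2)=\frac1\pi\int_{-\pi/2}^{\pi/2}(\phi\circ\Phi^{-1})\!\left(1-\exp\{-e^{-x/\beta_2}a_1(\gamma)\}\right)d\gamma .$$ (c) If $\beta_2<0$, $$J_{1,0}(x,\beta_2)=J_{1,0}(-x,-\beta_2),\qquad J_{0,1}(x,\beta_2)=-J_{0,1}(-x,-\beta_2),$$ where the right-hand sides are given by the formulas in (b) with $\beta_2$ replaced by $-\beta_2$ (also in $a_1$) and $x$ replaced by $-x$.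
   Context: $\phi$ and $\Phi$ denote the density and cumulative distribution function of the standard normal distribution. For $z_1,z_2\in\mathbb{R}$ put $$\gamma(z_1)=\pi\Phi(z_1)-\tfrac{\pi}{2},\qquad W(z_2)=-\log(1-\Phi(z_2)).$$ For $\beta_2\in[-1,1]$ let $$G_1(z_1,z_2)=\left(\frac{\pi}{2}+\beta_2\gamma(z_1)\right)\tan(\gamma(z_1))-\beta_2\log\left(\frac{W(z_2)\cos(\gamma(z_1))}{\pi/2+\beta_2\gamma(z_1)}\right),$$ and for $\beta_2\neq0$ and $-\frac{\pi}{2}<\gamma<\frac{\pi}{2}$ let $$a_1(\gamma)=\frac{\frac{\pi}{2}+\beta_2\gamma}{\cos\gamma}\exp\left\{\frac1{\beta_2}\left(\frac{\pi}{2}+\beta_2\gamma\right)\tan\gamma\right\}.$$ (The random variable $G_1(Z_1,Z_2)$ is $1$-stable with asymmetry parameter $\beta_2$.) The Hermite polynomials are $H_m(u)=(-1)^m\phi(u)^{-1}\frac{d^m}{du^m}\phi(u)$, so $H_0=1$, $H_1(u)=u$. The Hermite coefficients are $$J_{m_1,m_2}(x,\beta_2)=\mathrm{E}\left[\mathbf 1\{G_1(Z_1,Z_2)\le x\}\,H_{m_1}(Z_1)H_{m_2}(Z_2)\right],\qquad m_1,m_2\ge0,$$ and the Hermite rank is $m(x)=\min\{m_1+m_2\ge1: J_{m_1,m_2}(x,\beta_2)\ne0\}$. *)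

theory Defs
  imports "HOL-Probability.Probability" "HOL-Library.Extended_Nat"
begin

definition Phi :: "real \<Rightarrow> real" where
  "Phi = cdf std_normal_distribution"

text \<open>\<open>Phi\<close> is a bijection onto the open unit interval; \<open>inv Phi\<close> is meaningful only there.\<close>

abbreviation Phi_inv :: "real \<Rightarrow> real" where
  "Phi_inv \<equiv> inv Phi"

definition gam :: "real \<Rightarrow> real" where
  "gam z1 = pi * Phi z1 - pi / 2"

definition W :: "real \<Rightarrow> real" where
  "W z2 = - ln (1 - Phi z2)"

definition G1 :: "real \<Rightarrow> real \<Rightarrow> real \<Rightarrow> real" where
  "G1 \<beta>2 z1 z2 =
     (pi / 2 + \<beta>2 * gam z1) * tan (gam z1)
     - \<beta>2 * ln (W z2 * cos (gam z1) / (pi / 2 + \<beta>2 * gam z1))"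

definition a1 :: "real \<Rightarrow> real \<Rightarrow> real" where
  "a1 \<beta>2 \<gamma> =
     (pi / 2 + \<beta>2 * \<gamma>) / cos \<gamma> * exp (1 / \<beta>2 * (pi / 2 + \<beta>2 * \<gamma>) * tan \<gamma>)"

definition hermite :: "nat \<Rightarrow> real \<Rightarrow> real" where
  "hermite m u =
     (-1) ^ m * inverse (std_normal_density u) * (deriv ^^ m) std_normal_density u"

definition J ::
  "'w measure \<Rightarrow> ('w \<Rightarrow> real) \<Rightarrow> ('w \<Rightarrow> real) \<Rightarrow> nat \<Rightarrow> nat \<Rightarrow> real \<Rightarrow> real \<Rightarrow> real" where
  "J M Z1 Z2 m1 m2 x \<beta>2 =
     (LINT \<omega>|M. of_bool (G1 \<beta>2 (Z1 \<omega>) (Z2 \<omega>) \<le> x) * hermite m1 (Z1 \<omega>) * hermite m2 (Z2 \<omega>))"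

text \<open>The minimum is taken in \<open>enat\<close>, so that it is \<open>\<infinity>\<close> (rather than an unspecified number)
  should all coefficients of positive degree vanish; otherwise the infimum is attained.\<close>

definition hermite_rank ::
  "'w measure \<Rightarrow> ('w \<Rightarrow> real) \<Rightarrow> ('w \<Rightarrow> real) \<Rightarrow> real \<Rightarrow> real \<Rightarrow> enat" where
  "hermite_rank M Z1 Z2 x \<beta>2 =
     Inf {enat (m1 + m2) | m1 m2. m1 + m2 \<ge> 1 \<and> J M Z1 Z2 m1 m2 x \<beta>2 \<noteq> 0}"

end

theory Submission
  imports Defs
begin

text \<open>
  For \<open>\<beta> \<noteq> 0\<close> everything rests on the identity
  \<open>G1 \<beta> z1 z2 - x = \<beta> * (ln L - ln (W z2))\<close> with \<open>L = exp (- x / \<beta>) * a1 \<beta> (gam z1)\<close>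
  (lemma \<open>G1_diff\<close>).  As \<open>W\<close> is increasing, for fixed \<open>z1\<close> the event \<open>G1 \<beta> z1 z2 \<le> x\<close>
  is a half-line in \<open>z2\<close>: it lies above the threshold \<open>Phi_inv (1 - exp (- L))\<close> if \<open>\<beta> > 0\<close>
  and below it if \<open>\<beta> < 0\<close>.  A half-line has explicit zeroth and first standard normal moments:
  its first moment is plus or minus the density at the endpoint, because
  \<open>- z * std_normal_density z\<close> is the derivative of the density.

  By Fubini, integrating out \<open>z2\<close> therefore leaves for \<open>\<beta> > 0\<close> the two single integrals of
  \<open>J_pos\<close> over \<open>z1\<close>.  If \<open>Z1\<close> is standard normal, then \<open>gam Z1\<close> is uniform on
  \<open>(- pi / 2, pi / 2)\<close>; this quantile transform (\<open>integral_quantile\<close>) turns them into the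
  integrals over \<open>\<gamma>\<close>.  For \<open>\<beta> < 0\<close>, the reflection \<open>z1 \<mapsto> - z1\<close> preserves the normal law and
  maps the threshold for \<open>(x, \<beta>)\<close> to that for \<open>(- x, - \<beta>)\<close>, while the half-line is replaced
  by its complement (\<open>J_neg\<close>); the complement is harmless since the whole line has first
  moment zero.  For \<open>\<beta> = 0\<close> the event is a half-line in \<open>z1\<close> alone.

  The rank is one because some coefficient of degree one does not vanish: for \<open>\<beta> > 0\<close>,
  \<open>J\<^sub>0\<^sub>,\<^sub>1\<close> is the mean of a positive function, for \<open>\<beta> < 0\<close> it is the negative of such a mean,
  and for \<open>\<beta> = 0\<close>, \<open>J\<^sub>1\<^sub>,\<^sub>0\<close> is minus a value of the density.
\<close>

section \<open>The standard normal distribution function and its inverse\<close>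

abbreviation N :: "real measure" where "N \<equiv> std_normal_distribution"

interpretation N: cdf_distribution N
  unfolding cdf_distribution_def by (rule real_dist_normal_dist)

lemma integral_N: "f \<in> borel_measurable borel \<Longrightarrow> (\<integral>z. f z \<partial>N) = (\<integral>z. std_normal_density z * f z \<partial>lborel)"
  for f :: "real \<Rightarrow> real"
  by (subst integral_density) auto

lemma integrable_N: "f \<in> borel_measurable borel \<Longrightarrow> integrable N f \<longleftrightarrow> integrable lborel (\<lambda>z. std_normal_density z * f z)"
  for f :: "real \<Rightarrow> real"
  by (subst integrable_density) auto

lemma integrable_N_ident: "integrable N (\<lambda>z. z)"
  using integrable_std_normal_moment[of 1] by (simp add: integrable_N)

lemma integral_N_ident: "(\<integral>z. z \<partial>N) = 0"
  using integral_std_normal_moment_odd[of 0] by (simp add: integral_N)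

lemma measure_N_UNIV: "measure N UNIV = 1"
  using N.prob_space by simp

lemma AE_N: "AE z in lborel. P z \<Longrightarrow> AE z in N. P z"
  by (subst AE_density) auto

text \<open>Intervals of positive length have positive mass because the density vanishes nowhere.\<close>

lemma measure_N_Ioc_pos:
  assumes "x < y" shows "0 < measure N {x<..y}"
proof (rule ccontr)
  assume "\<not> ?thesis"
  hence "measure N {x<..y} = 0" using measure_nonneg[of N "{x<..y}"] by linarith
  hence "emeasure N {x<..y} = 0" by (simp add: N.emeasure_eq_measure)
  hence "AE z in lborel. z \<in> {x<..y} \<longrightarrow> ennreal (std_normal_density z) = 0"
    by (subst (asm) emeasure_density) (auto simp: nn_integral_0_iff_AE indicator_def elim!: eventually_mono split: if_splits)
  hence "AE z in lborel. z \<notin> {x<..y}"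
    by eventually_elim (use normal_density_pos[of 1 0] in \<open>force simp: ennreal_eq_0_iff not_le[symmetric]\<close>)
  hence "emeasure lborel {x<..y} = 0"
    by (subst (asm) AE_iff_measurable[of "{x<..y}"]) auto
  thus False using assms by simp
qed

lemma strict_mono_Phi: "strict_mono Phi"
  using N.cdf_diff_eq measure_N_Ioc_pos
  by (metis Phi_def diff_gt_0_iff_gt strict_monoI)

lemma isCont_Phi: "isCont Phi x"
proof -
  have "AE z in N. z \<notin> {x}" by (rule AE_N) (use AE_lborel_singleton[of x] in simp)
  hence "emeasure N {x} = 0" by (subst (asm) AE_iff_measurable[of "{x}"]) auto
  thus ?thesis unfolding Phi_def N.isCont_cdf by (simp add: measure_def)
qed

lemma Phi_bounds: "0 < Phi z" "Phi z < 1"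
proof -
  show "0 < Phi z"
    using strict_monoD[OF strict_mono_Phi, of "z - 1" z] N.cdf_nonneg[of "z - 1"] by (simp add: Phi_def)
  show "Phi z < 1"
    using strict_monoD[OF strict_mono_Phi, of "z" "z+1"] N.cdf_bounded_prob[of "z + 1"] by (simp add: Phi_def)
qed

lemma Phi_Phi_inv:
  assumes "0 < u" "u < 1" shows "Phi (Phi_inv u) = u"
proof -
  obtain a where a: "Phi a < u"
    using order_tendstoD(2)[OF N.cdf_lim_at_bot assms(1)]
    by (auto simp: Phi_def eventually_at_bot_linorder)
  obtain b where b: "u < Phi b"
    using order_tendstoD(1)[OF N.cdf_lim_at_top_prob assms(2)]
    by (auto simp: Phi_def eventually_at_top_linorder)
  have "a \<le> b" using a b strict_mono_less[OF strict_mono_Phi] by (metis less_trans less_imp_le)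
  then obtain z where "Phi z = u"
    using IVT[of Phi a u b] a b isCont_Phi by auto
  thus ?thesis by (metis f_inv_into_f rangeI)
qed

lemma le_Phi_iff: "0 < u \<Longrightarrow> u < 1 \<Longrightarrow> u \<le> Phi z \<longleftrightarrow> Phi_inv u \<le> z"
  using strict_mono_less_eq[OF strict_mono_Phi] Phi_Phi_inv by metis

lemma Phi_le_iff: "0 < u \<Longrightarrow> u < 1 \<Longrightarrow> Phi z \<le> u \<longleftrightarrow> z \<le> Phi_inv u"
  using strict_mono_less_eq[OF strict_mono_Phi] Phi_Phi_inv by metis

lemma Phi_inv_eq_pseudoinverse:
  assumes "u \<in> {0<..<1}" shows "N.I u = Phi_inv u"
proof (rule antisym)
  have u: "0 < u" "u < 1" using assms by auto
  have "u \<le> cdf N (Phi_inv u)" using Phi_Phi_inv[OF u] by (simp add: Phi_def)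
  thus "N.I u \<le> Phi_inv u" by (rule N.pseudoinverse[OF u, THEN iffD1])
  have "u \<le> cdf N (N.I u)" by (rule N.pseudoinverse[OF u, THEN iffD2, OF order_refl])
  thus "Phi_inv u \<le> N.I u" using le_Phi_iff[OF u] by (simp add: Phi_def)
qed

section \<open>Quantile transform and reflection\<close>

text \<open>Inverse transform sampling: a uniform variable on the unit interval is mapped to the normal
  law by the pseudoinverse of the distribution function, which here is the genuine inverse.
  The interval is rescaled so that \<open>\<gamma> = gam z\<close>.\<close>

lemma integral_quantile:
  fixes h :: "real \<Rightarrow> real"
  assumes [measurable]: "h \<in> borel_measurable borel"
  shows "(\<integral>z. h z \<partial>N) = 1 / pi * (LBINT \<gamma>:{- (pi / 2)<..<pi / 2}. h (Phi_inv (1 / pi * (\<gamma> + pi / 2))))"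
proof -
  have "(\<integral>z. h z \<partial>N) = (\<integral>z. h z \<partial>distr (restrict_space lborel {0<..<1}) borel N.I)"
    by (simp only: N.distr_I_eq_M)
  also have "\<dots> = (\<integral>u. h (N.I u) \<partial>restrict_space lborel {0<..<1})"
    by (intro integral_distr) auto
  also have "\<dots> = (\<integral>u. indicator {0<..<1} u * h (Phi_inv u) \<partial>lborel)"
    by (subst integral_restrict_space)
      (auto intro!: Bochner_Integration.integral_cong simp: indicator_def Phi_inv_eq_pseudoinverse)
  also have "\<dots> = 1 / pi * (\<integral>\<gamma>. indicator {0<..<1} (1 / 2 + 1 / pi * \<gamma>) * h (Phi_inv (1 / 2 + 1 / pi * \<gamma>)) \<partial>lborel)"
    by (subst lborel_integral_real_affine[where c="1/pi" and t="1/2"]) auto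
  also have "\<dots> = 1 / pi * (LBINT \<gamma>:{- (pi / 2)<..<pi / 2}. h (Phi_inv (1 / pi * (\<gamma> + pi / 2))))"
    unfolding set_lebesgue_integral_def
    by (intro arg_cong2[where f="(*)"] refl Bochner_Integration.integral_cong)
       (auto simp: indicator_def field_simps)
  finally show ?thesis .
qed

lemma integral_N_reflect:
  fixes h :: "real \<Rightarrow> real"
  assumes [measurable]: "h \<in> borel_measurable borel"
  shows "(\<integral>z. h (- z) \<partial>N) = (\<integral>z. h z \<partial>N)"
  unfolding integral_N[OF assms]
  by (subst integral_N, measurable, subst lborel_integral_real_affine[where c="-1" and t=0])
     (auto simp: std_normal_density_def)

lemma Phi_minus: "Phi (- z) = 1 - Phi z"
proof -
  have "Phi (- z) = (\<integral>y. indicator {..-z} y \<partial>N)" by (simp add: Phi_def cdf_def)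
  also have "\<dots> = (\<integral>y. indicator {..-z} (-y) \<partial>N)" by (rule integral_N_reflect[symmetric]) auto
  also have "\<dots> = (\<integral>y. 1 - indicator {..z} y \<partial>N)"
  proof (rule integral_cong_AE)
    have "AE y in N. y \<noteq> z" by (rule AE_N[OF AE_lborel_singleton])
    thus "AE y in N. indicator {..-z} (-y) = 1 - indicat_real {..z} y"
      by eventually_elim (auto simp: indicator_def)
  qed auto
  also have "\<dots> = 1 - Phi z"
    by (subst Bochner_Integration.integral_diff)
       (auto simp: Phi_def cdf_def measure_N_UNIV N.emeasure_eq_measure)
  finally show ?thesis .
qed

section \<open>Zeroth and first moments of half-lines\<close>

lemma DERIV_std_normal_density:
  "(std_normal_density has_real_derivative - x * std_normal_density x) (at x)"
  unfolding std_normal_density_def[abs_def]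
  by (rule derivative_eq_intros refl | simp)+

lemma std_normal_density_at_top: "(std_normal_density \<longlongrightarrow> 0) at_top"
proof -
  have "((\<lambda>x::real. (1 / sqrt (2 * pi)) * exp (- x\<^sup>2 / 2)) \<longlongrightarrow> 0) at_top"
    by real_asymp
  thus ?thesis by (simp add: std_normal_density_def[abs_def])
qed

text \<open>The integrand \<open>z * std_normal_density z\<close> has the primitive \<open>- std_normal_density\<close>, which
  vanishes at infinity, so only the endpoint \<open>b\<close> contributes.\<close>

lemma integral_ident_atLeast:
  "(\<integral>z. of_bool (b \<le> z) * z \<partial>N) = std_normal_density b"
proof -
  have int: "integrable lborel (\<lambda>x. x * std_normal_density x)"
    using integrable_std_normal_moment[of 1] by (simp add: mult.commute)
  have "(LBINT x=ereal b..\<infinity>. x * std_normal_density x) = 0 - (- std_normal_density b)"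
  proof (rule interval_integral_FTC_integrable[where F="\<lambda>x. - std_normal_density x"])
    show "((\<lambda>x. - std_normal_density x) has_vector_derivative x * std_normal_density x) (at x)" for x
      using DERIV_minus[OF DERIV_std_normal_density[of x]]
      by (simp add: has_real_derivative_iff_has_vector_derivative)
    show "isCont (\<lambda>x. x * std_normal_density x) x" for x
      unfolding std_normal_density_def by (intro continuous_intros) auto
    show "set_integrable lborel (einterval (ereal b) \<infinity>) (\<lambda>x. x * std_normal_density x)"
      unfolding set_integrable_def by (rule integrable_mult_indicator[OF _ int]) auto
    have "isCont std_normal_density b" using DERIV_std_normal_density DERIV_isCont by blast
    hence "((\<lambda>x. - std_normal_density x) \<longlongrightarrow> - std_normal_density b) (at_right b)"
      by (intro tendsto_minus) (simp add: isCont_def filterlim_at_split)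
    thus "(((\<lambda>x. - std_normal_density x) \<circ> real_of_ereal) \<longlongrightarrow> - std_normal_density b) (at_right (ereal b))"
      by (simp add: ereal_tendsto_simps1)
    show "(((\<lambda>x. - std_normal_density x) \<circ> real_of_ereal) \<longlongrightarrow> 0) (at_left \<infinity>)"
      using tendsto_minus[OF std_normal_density_at_top] by (simp add: ereal_tendsto_simps1)
  qed auto
  \<comment> \<open>The interval integral is over the open half-line; its endpoint is a null set.\<close>
  moreover have "(LBINT x=ereal b..\<infinity>. x * std_normal_density x) = (\<integral>z. of_bool (b < z) * (z * std_normal_density z) \<partial>lborel)"
    unfolding interval_lebesgue_integral_def set_lebesgue_integral_def
    by (auto intro!: Bochner_Integration.integral_cong simp: einterval_def indicator_def)
  moreover have "\<dots> = (\<integral>z. of_bool (b \<le> z) * (z * std_normal_density z) \<partial>lborel)"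
  proof (rule integral_cong_AE)
    show "AE z in lborel. of_bool (b < z) * (z * std_normal_density z) = of_bool (b \<le> z) * (z * std_normal_density z)"
      using AE_lborel_singleton[of b] by eventually_elim auto
  qed auto
  moreover have "\<dots> = (\<integral>z. of_bool (b \<le> z) * z \<partial>N)"
    by (subst integral_N) (auto simp: mult_ac)
  ultimately show ?thesis by simp
qed

lemma integral_ident_atMost:
  "(\<integral>z. of_bool (z \<le> b) * z \<partial>N) = - std_normal_density b"
proof -
  have "(\<integral>z. of_bool (z \<le> b) * z \<partial>N) = (\<integral>z. - (of_bool (- b \<le> - z) * (- z)) \<partial>N)"
    by (auto intro!: Bochner_Integration.integral_cong)
  also have "\<dots> = (\<integral>z. - (of_bool (- b \<le> z) * z) \<partial>N)"
    by (rule integral_N_reflect) auto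
  also have "\<dots> = - std_normal_density b"
    using integral_ident_atLeast[of "-b"] by (simp add: std_normal_density_def)
  finally show ?thesis .
qed

lemma integral_atMost: "(\<integral>z. of_bool (z \<le> b) \<partial>N) = Phi b"
proof -
  have "(\<integral>z. of_bool (z \<le> b) \<partial>N) = (\<integral>z. indicat_real {..b} z \<partial>N)"
    by (auto intro!: Bochner_Integration.integral_cong simp: indicator_def)
  also have "\<dots> = measure N {..b}" by simp
  finally show ?thesis by (simp only: Phi_def cdf_def)
qed

lemma integral_atLeast: "(\<integral>z. of_bool (b \<le> z) \<partial>N) = 1 - Phi b"
proof -
  have "(\<integral>z. of_bool (b \<le> z) \<partial>N) = (\<integral>z. (of_bool (- z \<le> - b) :: real) \<partial>N)"
    by simp
  also have "\<dots> = (\<integral>z. of_bool (z \<le> - b) \<partial>N)"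
    by (rule integral_N_reflect[of "\<lambda>z. of_bool (z \<le> - b)"]) measurable
  finally show ?thesis by (simp add: integral_atMost Phi_minus)
qed

section \<open>Sublevel sets of \<open>G1\<close>\<close>

lemma gam_bounds: "- (pi / 2) < gam z" "gam z < pi / 2"
  using Phi_bounds[of z] by (auto simp: gam_def)

lemma gam_minus: "gam (- z) = - gam z"
  by (simp add: gam_def Phi_minus algebra_simps)

lemma gam_Phi_inv:
  "\<gamma> \<in> {- (pi / 2)<..<pi / 2} \<Longrightarrow> gam (Phi_inv (1 / pi * (\<gamma> + pi / 2))) = \<gamma>"
  unfolding gam_def by (subst Phi_Phi_inv) (auto simp: field_simps)

lemma W_pos: "0 < W z"
  using Phi_bounds[of z] by (simp add: W_def)

lemma linear_factor_pos:
  fixes \<beta> \<gamma> :: real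
  assumes "\<bar>\<beta>\<bar> \<le> 1" "- (pi / 2) < \<gamma>" "\<gamma> < pi / 2"
  shows "0 < pi / 2 + \<beta> * \<gamma>"
proof -
  have "\<bar>\<beta> * \<gamma>\<bar> \<le> 1 * \<bar>\<gamma>\<bar>" unfolding abs_mult by (rule mult_right_mono) (use assms in auto)
  also have "\<dots> < pi / 2" using assms by auto
  finally show ?thesis by linarith
qed

text \<open>For \<open>\<beta> \<noteq> 0\<close>, the value that \<open>W z2\<close> has to attain for \<open>G1 \<beta> z z2 = x\<close> to hold.\<close>

definition level :: "real \<Rightarrow> real \<Rightarrow> real \<Rightarrow> real" where
  "level x \<beta> z = exp (- x / \<beta>) * a1 \<beta> (gam z)"

lemma level_pos: "\<bar>\<beta>\<bar> \<le> 1 \<Longrightarrow> 0 < level x \<beta> z"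
  unfolding level_def a1_def using linear_factor_pos gam_bounds[of z]
  by (simp add: cos_gt_zero_pi)

text \<open>The function \<open>a1\<close> depends on \<open>\<beta>\<close> and \<open>\<gamma>\<close> only through \<open>\<beta> * \<gamma>\<close>, \<open>cos \<gamma>\<close> and \<open>tan \<gamma> / \<beta>\<close>, which
  are all invariant under a joint change of sign.\<close>

lemma level_reflect: "level x \<beta> (- z) = level (- x) (- \<beta>) z"
  by (simp add: level_def a1_def gam_minus)

text \<open>The logarithm of \<open>a1\<close> collects all terms of \<open>G1\<close> that do not involve \<open>z2\<close>.  The bound on \<open>\<beta>\<close>
  keeps \<open>pi / 2 + \<beta> * gam z1\<close> positive, so that the logarithms split.\<close>

lemma G1_diff:
  assumes "\<beta> \<noteq> 0" "\<bar>\<beta>\<bar> \<le> 1"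
  shows "G1 \<beta> z1 z2 - x = \<beta> * (ln (level x \<beta> z1) - ln (W z2))"
proof -
  define A where "A = pi / 2 + \<beta> * gam z1"
  define C where "C = cos (gam z1)"
  have A: "0 < A" unfolding A_def using assms(2) gam_bounds by (rule linear_factor_pos)
  have C: "0 < C" unfolding C_def using gam_bounds[of z1] by (simp add: cos_gt_zero_pi)
  have 1: "ln (level x \<beta> z1) = - x / \<beta> + (ln A - ln C + A * tan (gam z1) / \<beta>)"
    unfolding level_def a1_def A_def[symmetric] C_def[symmetric] using A C
    by (simp add: ln_mult ln_div)
  have 2: "G1 \<beta> z1 z2 = A * tan (gam z1) - \<beta> * (ln (W z2) + ln C - ln A)"
    unfolding G1_def A_def[symmetric] C_def[symmetric] using A C W_pos[of z2]
    by (simp add: ln_mult ln_div)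
  show ?thesis unfolding 1 2 using assms(1) by (simp add: field_simps)
qed

text \<open>The solution \<open>z2\<close> of \<open>W z2 = level x \<beta> z\<close>.  The probability that a normal variable exceeds it
  is \<open>exp (- level x \<beta> z)\<close>, that is, \<open>W\<close> carries the normal law to the standard exponential one.\<close>

definition threshold :: "real \<Rightarrow> real \<Rightarrow> real \<Rightarrow> real" where
  "threshold x \<beta> z = Phi_inv (1 - exp (- level x \<beta> z))"

lemma Phi_threshold: "\<bar>\<beta>\<bar> \<le> 1 \<Longrightarrow> Phi (threshold x \<beta> z) = 1 - exp (- level x \<beta> z)"
  unfolding threshold_def using level_pos[of \<beta> x z] by (intro Phi_Phi_inv) auto

lemma level_le_W_iff:
  assumes "\<bar>\<beta>\<bar> \<le> 1" shows "level x \<beta> z1 \<le> W z2 \<longleftrightarrow> threshold x \<beta> z1 \<le> z2"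
proof -
  have "level x \<beta> z1 \<le> W z2 \<longleftrightarrow> ln (1 - Phi z2) \<le> ln (exp (- level x \<beta> z1))"
    by (auto simp: W_def)
  also have "\<dots> \<longleftrightarrow> 1 - Phi z2 \<le> exp (- level x \<beta> z1)"
    using Phi_bounds[of z2] by (subst ln_le_cancel_iff) auto
  finally have "level x \<beta> z1 \<le> W z2 \<longleftrightarrow> 1 - Phi z2 \<le> exp (- level x \<beta> z1)" .
  thus ?thesis
    using strict_mono_less_eq[OF strict_mono_Phi, of "threshold x \<beta> z1" z2] Phi_threshold[OF assms, of x z1]
    by auto
qed

lemma W_le_level_iff:
  assumes "\<bar>\<beta>\<bar> \<le> 1" shows "W z2 \<le> level x \<beta> z1 \<longleftrightarrow> z2 \<le> threshold x \<beta> z1"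
proof -
  have "W z2 \<le> level x \<beta> z1 \<longleftrightarrow> exp (- level x \<beta> z1) \<le> 1 - Phi z2"
    using Phi_bounds[of z2] by (auto simp: W_def ln_ge_iff minus_le_iff)
  thus ?thesis
    using strict_mono_less_eq[OF strict_mono_Phi, of z2 "threshold x \<beta> z1"] Phi_threshold[OF assms, of x z1]
    by auto
qed

lemma G1_le_iff_pos:
  assumes "0 < \<beta>" "\<beta> \<le> 1" shows "G1 \<beta> z1 z2 \<le> x \<longleftrightarrow> threshold x \<beta> z1 \<le> z2"
proof -
  have b: "\<bar>\<beta>\<bar> \<le> 1" using assms by simp
  have "G1 \<beta> z1 z2 \<le> x \<longleftrightarrow> \<beta> * (ln (level x \<beta> z1) - ln (W z2)) \<le> 0"
    using G1_diff[of \<beta> z1 z2 x] assms b by (metis diff_le_0_iff_le less_irrefl)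
  also have "\<dots> \<longleftrightarrow> level x \<beta> z1 \<le> W z2"
    using assms level_pos[OF b] W_pos by (simp add: mult_le_0_iff)
  finally show ?thesis using level_le_W_iff[OF b] by simp
qed

lemma G1_le_iff_neg:
  assumes "\<beta> < 0" "-1 \<le> \<beta>" shows "G1 \<beta> z1 z2 \<le> x \<longleftrightarrow> z2 \<le> threshold x \<beta> z1"
proof -
  have b: "\<bar>\<beta>\<bar> \<le> 1" using assms by simp
  have "G1 \<beta> z1 z2 \<le> x \<longleftrightarrow> \<beta> * (ln (level x \<beta> z1) - ln (W z2)) \<le> 0"
    using G1_diff[of \<beta> z1 z2 x] assms b by (metis diff_le_0_iff_le less_irrefl)
  also have "\<dots> \<longleftrightarrow> W z2 \<le> level x \<beta> z1"
    using assms level_pos[OF b] W_pos by (simp add: mult_le_0_iff)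
  finally show ?thesis using W_le_level_iff[OF b] by simp
qed

lemma G1_zero_le_iff: "G1 0 z1 z2 \<le> x \<longleftrightarrow> z1 \<le> Phi_inv (1 / pi * (arctan (2 / pi * x) + pi / 2))"
proof -
  let ?t = "arctan (2 / pi * x)"
  have t: "- (pi / 2) < ?t" "?t < pi / 2" by (rule arctan_lbound arctan_ubound)+
  have "G1 0 z1 z2 \<le> x \<longleftrightarrow> tan (gam z1) \<le> tan ?t"
    unfolding tan_arctan by (simp add: G1_def field_simps)
  also have "\<dots> \<longleftrightarrow> gam z1 \<le> ?t"
    using gam_bounds[of z1] t by (intro tan_mono_le_eq)
  also have "\<dots> \<longleftrightarrow> Phi z1 \<le> 1 / pi * (?t + pi / 2)"
    by (auto simp: gam_def field_simps)
  also have "\<dots> \<longleftrightarrow> z1 \<le> Phi_inv (1 / pi * (?t + pi / 2))"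
    using t by (intro Phi_le_iff) (auto simp: field_simps)
  finally show ?thesis .
qed

section \<open>Measurability\<close>

lemma measurable_Phi [measurable]: "Phi \<in> borel_measurable borel"
  unfolding Phi_def by measurable

lemma measurable_gam [measurable]: "gam \<in> borel_measurable borel"
  unfolding gam_def[abs_def] by measurable

lemma measurable_W [measurable]: "W \<in> borel_measurable borel"
  unfolding W_def[abs_def] by measurable

lemma measurable_G1 [measurable]:
  assumes [measurable]: "f \<in> borel_measurable M" "g \<in> borel_measurable M"
  shows "(\<lambda>\<omega>. G1 \<beta> (f \<omega>) (g \<omega>)) \<in> borel_measurable M"
  unfolding G1_def tan_def by measurable

lemma measurable_level [measurable]: "level x \<beta> \<in> borel_measurable borel"
  unfolding level_def[abs_def] a1_def tan_def by measurable

section \<open>Coefficients of total degree one\<close>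

lemma hermite_0: "hermite 0 u = 1"
  using normal_density_pos[of 1 0 u] by (simp add: hermite_def)

lemma hermite_1: "hermite 1 u = u"
  using normal_density_pos[of 1 0 u] DERIV_imp_deriv[OF DERIV_std_normal_density]
  by (simp add: hermite_def)

text \<open>The function is a partial integral of a jointly measurable one, so Fubini makes it measurable.\<close>

lemma measurable_density_threshold:
  assumes "0 < \<beta>" "\<beta> \<le> 1"
  shows "(\<lambda>z. std_normal_density (threshold x \<beta> z)) \<in> borel_measurable borel"
proof -
  have "(\<lambda>z. \<integral>z2. of_bool (G1 \<beta> z z2 \<le> x) * z2 \<partial>N) \<in> borel_measurable borel"
    by measurable
  thus ?thesis by (simp add: G1_le_iff_pos[OF assms] integral_ident_atLeast)
qed

locale std_normal_pair = prob_space M for M :: "'w measure" +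
  fixes Z1 Z2 :: "'w \<Rightarrow> real"
  assumes Z1: "distributed M lborel Z1 std_normal_density"
    and Z2: "distributed M lborel Z2 std_normal_density"
    and indep: "indep_var borel Z1 borel Z2"
begin

lemma joint_distr: "distr M (borel \<Otimes>\<^sub>M borel) (\<lambda>\<omega>. (Z1 \<omega>, Z2 \<omega>)) = N \<Otimes>\<^sub>M N"
proof -
  have "distr M borel Z1 = N" "distr M borel Z2 = N"
    using distributed_distr_eq_density[OF Z1] distributed_distr_eq_density[OF Z2]
    by (metis distr_cong sets_lborel)+
  thus ?thesis using indep unfolding indep_var_distribution_eq by metis
qed

lemma Z_measurable [measurable]: "Z1 \<in> borel_measurable M" "Z2 \<in> borel_measurable M"
  using distributed_measurable[OF Z1] distributed_measurable[OF Z2] by auto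

text \<open>The growth bound covers both degree-one integrands and ensures integrability, as normal
  variables have finite first absolute moments.\<close>

lemma expectation_eq_iterated:
  fixes f :: "real \<times> real \<Rightarrow> real"
  assumes [measurable]: "f \<in> borel_measurable borel"
    and bound: "\<And>z1 z2. \<bar>f (z1, z2)\<bar> \<le> \<bar>z1\<bar> + \<bar>z2\<bar>"
  shows "(\<integral>\<omega>. f (Z1 \<omega>, Z2 \<omega>) \<partial>M) = (\<integral>z1. (\<integral>z2. f (z1, z2) \<partial>N) \<partial>N)"
proof -
  interpret P: pair_prob_space N N ..
  have f [measurable]: "f \<in> borel_measurable (borel \<Otimes>\<^sub>M borel)" by (simp add: borel_prod)
  have 1: "(\<integral>\<omega>. f (Z1 \<omega>, Z2 \<omega>) \<partial>M) = (\<integral>p. f p \<partial>(N \<Otimes>\<^sub>M N))"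
    unfolding joint_distr[symmetric] by (subst integral_distr) auto
  have "integrable M Z1" "integrable M Z2"
    using integrable_std_normal_moment[of 1] by (auto intro!: distributed_integrable[OF Z1, THEN iffD1, of "\<lambda>x. x"] distributed_integrable[OF Z2, THEN iffD1, of "\<lambda>x. x"])
  hence "integrable M (\<lambda>\<omega>. \<bar>Z1 \<omega>\<bar> + \<bar>Z2 \<omega>\<bar>)" by auto
  hence "integrable M (\<lambda>\<omega>. f (Z1 \<omega>, Z2 \<omega>))"
    by (rule Bochner_Integration.integrable_bound) (use bound in auto)
  hence "integrable (N \<Otimes>\<^sub>M N) f"
    unfolding joint_distr[symmetric] by (subst integrable_distr_eq) auto
  from P.integral_fst'[OF this] show ?thesis unfolding 1 by simp
qed

lemma J_1_0:
  "J M Z1 Z2 1 0 x \<beta> = (\<integral>z1. z1 * (\<integral>z2. of_bool (G1 \<beta> z1 z2 \<le> x) \<partial>N) \<partial>N)"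
proof -
  have "J M Z1 Z2 1 0 x \<beta> = (\<integral>z1. (\<integral>z2. (\<lambda>(z1, z2). of_bool (G1 \<beta> z1 z2 \<le> x) * z1) (z1, z2) \<partial>N) \<partial>N)"
    unfolding J_def hermite_0 hermite_1
    by (subst expectation_eq_iterated[symmetric])
       (auto simp: borel_prod[symmetric] of_bool_def)
  thus ?thesis by (simp add: mult.commute)
qed

lemma J_0_1:
  "J M Z1 Z2 0 1 x \<beta> = (\<integral>z1. (\<integral>z2. of_bool (G1 \<beta> z1 z2 \<le> x) * z2 \<partial>N) \<partial>N)"
proof -
  have "J M Z1 Z2 0 1 x \<beta> = (\<integral>z1. (\<integral>z2. (\<lambda>(z1, z2). of_bool (G1 \<beta> z1 z2 \<le> x) * z2) (z1, z2) \<partial>N) \<partial>N)"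
    unfolding J_def hermite_0 hermite_1
    by (subst expectation_eq_iterated[symmetric])
       (auto simp: borel_prod[symmetric] of_bool_def)
  thus ?thesis by simp
qed

text \<open>Here the event depends on \<open>z1\<close> alone, so \<open>Z2\<close> contributes only its mean, which is zero.\<close>

lemma J_zero:
  "J M Z1 Z2 1 0 x 0 = - std_normal_density (Phi_inv (1 / pi * (arctan (2 / pi * x) + pi / 2)))"
  "J M Z1 Z2 0 1 x 0 = 0"
proof -
  show "J M Z1 Z2 1 0 x 0 = - std_normal_density (Phi_inv (1 / pi * (arctan (2 / pi * x) + pi / 2)))"
    unfolding J_1_0 G1_zero_le_iff
    using integral_ident_atMost[of "Phi_inv (1 / pi * (arctan (2 / pi * x) + pi / 2))"]
    by (simp add: measure_N_UNIV mult.commute[of "of_bool _"])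
  show "J M Z1 Z2 0 1 x 0 = 0"
    unfolding J_0_1 G1_zero_le_iff by (simp add: integral_N_ident)
qed

lemma J_pos:
  assumes "0 < \<beta>" "\<beta> \<le> 1"
  shows "J M Z1 Z2 1 0 x \<beta> = (\<integral>z. z * exp (- level x \<beta> z) \<partial>N)"
    and "J M Z1 Z2 0 1 x \<beta> = (\<integral>z. std_normal_density (threshold x \<beta> z) \<partial>N)"
  unfolding J_1_0 J_0_1 G1_le_iff_pos[OF assms] integral_atLeast integral_ident_atLeast
  using assms by (simp_all add: Phi_threshold)

text \<open>After the reflection of \<open>z1\<close> the event is, for fixed \<open>z1\<close>, the half-line below the threshold
  for \<open>(- x, - \<beta>)\<close>.  In the first coefficient two signs cancel, one from the factor \<open>z1\<close> and one
  from taking complements; in the second only the latter remains.\<close>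

lemma J_neg:
  assumes "\<beta> < 0" "-1 \<le> \<beta>"
  shows "J M Z1 Z2 1 0 x \<beta> = J M Z1 Z2 1 0 (- x) (- \<beta>)"
    and "J M Z1 Z2 0 1 x \<beta> = - J M Z1 Z2 0 1 (- x) (- \<beta>)"
proof -
  have b: "0 < - \<beta>" "- \<beta> \<le> 1" "\<bar>\<beta>\<bar> \<le> 1" using assms by auto
  have refl: "threshold x \<beta> (- z) = threshold (- x) (- \<beta>) z" for z
    by (simp add: threshold_def level_reflect)
  have "J M Z1 Z2 1 0 x \<beta> = (\<integral>z. z * (1 - exp (- level x \<beta> z)) \<partial>N)"
    unfolding J_1_0 G1_le_iff_neg[OF assms] integral_atMost by (simp add: Phi_threshold b)
  also have "\<dots> = (\<integral>z. - z * (1 - exp (- level x \<beta> (- z))) \<partial>N)"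
    by (rule integral_N_reflect[symmetric]) measurable
  also have "\<dots> = (\<integral>z. z * exp (- level (- x) (- \<beta>) z) - z \<partial>N)"
    by (simp add: level_reflect algebra_simps)
  also have "\<dots> = (\<integral>z. z * exp (- level (- x) (- \<beta>) z) \<partial>N) - (\<integral>z. z \<partial>N)"
  proof (intro Bochner_Integration.integral_diff integrable_N_ident)
    show "integrable N (\<lambda>z. z * exp (- level (- x) (- \<beta>) z))"
      by (rule Bochner_Integration.integrable_bound[OF integrable_N_ident])
         (use level_pos[of "- \<beta>"] b in \<open>auto simp: abs_mult less_imp_le intro!: mult_right_le_one_le\<close>)
  qed
  finally show "J M Z1 Z2 1 0 x \<beta> = J M Z1 Z2 1 0 (- x) (- \<beta>)"
    unfolding J_pos[OF b(1,2)] by (simp add: integral_N_ident)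
  have "J M Z1 Z2 0 1 x \<beta> = (\<integral>z. (\<integral>z2. of_bool (G1 \<beta> z z2 \<le> x) * z2 \<partial>N) \<partial>N)"
    by (rule J_0_1)
  also have "\<dots> = (\<integral>z. (\<integral>z2. of_bool (G1 \<beta> (- z) z2 \<le> x) * z2 \<partial>N) \<partial>N)"
    by (rule integral_N_reflect[symmetric]) measurable
  also have "\<dots> = - (\<integral>z. std_normal_density (threshold (- x) (- \<beta>) z) \<partial>N)"
    unfolding G1_le_iff_neg[OF assms] integral_ident_atMost refl by simp
  finally show "J M Z1 Z2 0 1 x \<beta> = - J M Z1 Z2 0 1 (- x) (- \<beta>)"
    unfolding J_pos[OF b(1,2)] .
qed

lemma J_pos_quantile:
  assumes "0 < \<beta>" "\<beta> \<le> 1"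
  shows "J M Z1 Z2 1 0 x \<beta> = 1 / pi * (LBINT \<gamma>:{- (pi / 2)<..<pi / 2}.
           exp (- (exp (- x / \<beta>) * a1 \<beta> \<gamma>)) * Phi_inv (1 / pi * (\<gamma> + pi / 2)))"
    and "J M Z1 Z2 0 1 x \<beta> = 1 / pi * (LBINT \<gamma>:{- (pi / 2)<..<pi / 2}.
           (std_normal_density \<circ> Phi_inv) (1 - exp (- (exp (- x / \<beta>) * a1 \<beta> \<gamma>))))"
proof -
  have lvl: "level x \<beta> (Phi_inv (1 / pi * (\<gamma> + pi / 2))) = exp (- x / \<beta>) * a1 \<beta> \<gamma>"
    if "\<gamma> \<in> {- (pi / 2)<..<pi / 2}" for \<gamma>
    using gam_Phi_inv[OF that] by (simp add: level_def)
  show "J M Z1 Z2 1 0 x \<beta> = 1 / pi * (LBINT \<gamma>:{- (pi / 2)<..<pi / 2}.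
           exp (- (exp (- x / \<beta>) * a1 \<beta> \<gamma>)) * Phi_inv (1 / pi * (\<gamma> + pi / 2)))"
    unfolding J_pos[OF assms]
    by (subst integral_quantile, measurable,
        intro arg_cong2[where f="(*)"] refl set_lebesgue_integral_cong, simp)
       (use lvl in \<open>auto simp: mult.commute\<close>)
  have thr: "(\<lambda>z. std_normal_density (threshold x \<beta> z)) \<in> borel_measurable borel"
    by (rule measurable_density_threshold[OF assms])
  show "J M Z1 Z2 0 1 x \<beta> = 1 / pi * (LBINT \<gamma>:{- (pi / 2)<..<pi / 2}.
           (std_normal_density \<circ> Phi_inv) (1 - exp (- (exp (- x / \<beta>) * a1 \<beta> \<gamma>))))"
    unfolding J_pos[OF assms]
    by (subst integral_quantile[OF thr],
        intro arg_cong2[where f="(*)"] refl set_lebesgue_integral_cong) (use lvl in \<open>auto simp: threshold_def\<close>)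
qed

lemma J_0_1_pos:
  assumes "0 < \<beta>" "\<beta> \<le> 1"
  shows "0 < J M Z1 Z2 0 1 x \<beta>"
proof -
  let ?h = "\<lambda>z. std_normal_density (threshold x \<beta> z)"
  have [measurable]: "?h \<in> borel_measurable borel"
    by (rule measurable_density_threshold[OF assms])
  have int: "integrable N ?h"
  proof (rule N.integrable_const_bound[where B="1 / sqrt (2 * pi)"])
    have "exp (- (t\<^sup>2 / 2)) / sqrt (2 * pi) \<le> 1 / sqrt (2 * pi)" for t :: real
      by (intro divide_right_mono) auto
    thus "AE z in N. norm (?h z) \<le> 1 / sqrt (2 * pi)"
      by (intro AE_I2) (auto simp: std_normal_density_def)
  qed measurable
  have "(\<integral>z. ?h z \<partial>N) \<noteq> 0"
    using integral_nonneg_eq_0_iff_AE[OF int] normal_density_pos[of 1 0] N.AE_False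
    by (simp add: less_imp_le less_imp_neq[symmetric])
  moreover have "0 \<le> (\<integral>z. ?h z \<partial>N)" by simp
  ultimately show ?thesis unfolding J_pos[OF assms] by linarith
qed

lemma hermite_rank_eq_1:
  assumes "-1 \<le> \<beta>" "\<beta> \<le> 1"
  shows "hermite_rank M Z1 Z2 x \<beta> = 1"
proof -
  let ?D = "{enat (m1 + m2) | m1 m2. m1 + m2 \<ge> 1 \<and> J M Z1 Z2 m1 m2 x \<beta> \<noteq> 0}"
  have "J M Z1 Z2 1 0 x \<beta> \<noteq> 0 \<or> J M Z1 Z2 0 1 x \<beta> \<noteq> 0"
  proof (cases \<beta> "0 :: real" rule: linorder_cases)
    case less
    thus ?thesis using J_neg(2)[OF less assms(1), of x] J_0_1_pos[of "- \<beta>" "- x"] assms by auto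
  next
    case equal
    thus ?thesis using J_zero(1)[of x] normal_density_pos[of 1 0] by (auto simp: less_imp_neq[symmetric])
  next
    case greater
    thus ?thesis using J_0_1_pos[OF greater assms(2), of x] by auto
  qed
  hence "enat 1 \<in> ?D" by force
  moreover have "enat 1 \<le> d" if "d \<in> ?D" for d
    using that by auto
  ultimately show ?thesis
    unfolding hermite_rank_def one_enat_def by (intro antisym Inf_lower Inf_greatest)
qed

end

section \<open>Hermite coefficients and rank of the sublevel indicator\<close>

theorem theorem2:
  fixes M :: "'w measure" and Z1 Z2 :: "'w \<Rightarrow> real" and \<beta>2 :: real
  assumes "prob_space M"
    and "distributed M lborel Z1 std_normal_density"
    and "distributed M lborel Z2 std_normal_density"
    and "prob_space.indep_var M borel Z1 borel Z2"
    and "-1 \<le> \<beta>2" and "\<beta>2 \<le> 1"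
  shows "\<forall>x::real.
    hermite_rank M Z1 Z2 x \<beta>2 = 1 \<and>
    (\<beta>2 = 0 \<longrightarrow>
       J M Z1 Z2 1 0 x 0
         = - (std_normal_density \<circ> Phi_inv) (1 / pi * (arctan (2 / pi * x) + pi / 2)) \<and>
       J M Z1 Z2 0 1 x 0 = 0) \<and>
    (\<beta>2 > 0 \<longrightarrow>
       J M Z1 Z2 1 0 x \<beta>2
         = 1 / pi * (LBINT \<gamma>:{- (pi / 2)<..<pi / 2}.
             exp (- (exp (- x / \<beta>2) * a1 \<beta>2 \<gamma>)) * Phi_inv (1 / pi * (\<gamma> + pi / 2))) \<and>
       J M Z1 Z2 0 1 x \<beta>2
         = 1 / pi * (LBINT \<gamma>:{- (pi / 2)<..<pi / 2}.
             (std_normal_density \<circ> Phi_inv) (1 - exp (- (exp (- x / \<beta>2) * a1 \<beta>2 \<gamma>))))) \<and>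
    (\<beta>2 < 0 \<longrightarrow>
       J M Z1 Z2 1 0 x \<beta>2 = J M Z1 Z2 1 0 (- x) (- \<beta>2) \<and>
       J M Z1 Z2 1 0 (- x) (- \<beta>2)
         = 1 / pi * (LBINT \<gamma>:{- (pi / 2)<..<pi / 2}.
             exp (- (exp (- (- x) / (- \<beta>2)) * a1 (- \<beta>2) \<gamma>)) * Phi_inv (1 / pi * (\<gamma> + pi / 2))) \<and>
       J M Z1 Z2 0 1 x \<beta>2 = - J M Z1 Z2 0 1 (- x) (- \<beta>2) \<and>
       J M Z1 Z2 0 1 (- x) (- \<beta>2)
         = 1 / pi * (LBINT \<gamma>:{- (pi / 2)<..<pi / 2}.
             (std_normal_density \<circ> Phi_inv)
               (1 - exp (- (exp (- (- x) / (- \<beta>2)) * a1 (- \<beta>2) \<gamma>)))))"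
proof -
  interpret std_normal_pair M Z1 Z2
    using assms(1-4) by (intro std_normal_pair.intro std_normal_pair_axioms.intro)
  show ?thesis
  proof (intro allI conjI impI)
    fix x
    show "hermite_rank M Z1 Z2 x \<beta>2 = 1" by (rule hermite_rank_eq_1[OF assms(5,6)])
  next
    fix x
    show "J M Z1 Z2 1 0 x 0 = - (std_normal_density \<circ> Phi_inv) (1 / pi * (arctan (2 / pi * x) + pi / 2))"
      using J_zero(1) by simp
    show "J M Z1 Z2 0 1 x 0 = 0" by (rule J_zero(2))
  next
    fix x assume "0 < \<beta>2"
    note q = J_pos_quantile[OF this assms(6), of x]
    show "J M Z1 Z2 1 0 x \<beta>2 = 1 / pi * (LBINT \<gamma>:{- (pi / 2)<..<pi / 2}.
            exp (- (exp (- x / \<beta>2) * a1 \<beta>2 \<gamma>)) * Phi_inv (1 / pi * (\<gamma> + pi / 2)))"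
      by (rule q(1))
    show "J M Z1 Z2 0 1 x \<beta>2 = 1 / pi * (LBINT \<gamma>:{- (pi / 2)<..<pi / 2}.
            (std_normal_density \<circ> Phi_inv) (1 - exp (- (exp (- x / \<beta>2) * a1 \<beta>2 \<gamma>))))"
      by (rule q(2))
  next
    fix x assume neg: "\<beta>2 < 0"
    hence "0 < - \<beta>2" "- \<beta>2 \<le> 1" using assms(5) by auto
    note q = J_pos_quantile[OF this, of "- x"]
    show "J M Z1 Z2 1 0 x \<beta>2 = J M Z1 Z2 1 0 (- x) (- \<beta>2)"
      by (rule J_neg(1)[OF neg assms(5)])
    show "J M Z1 Z2 1 0 (- x) (- \<beta>2) = 1 / pi * (LBINT \<gamma>:{- (pi / 2)<..<pi / 2}.
            exp (- (exp (- (- x) / (- \<beta>2)) * a1 (- \<beta>2) \<gamma>)) * Phi_inv (1 / pi * (\<gamma> + pi / 2)))"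
      by (rule q(1))
    show "J M Z1 Z2 0 1 x \<beta>2 = - J M Z1 Z2 0 1 (- x) (- \<beta>2)"
      by (rule J_neg(2)[OF neg assms(5)])
    show "J M Z1 Z2 0 1 (- x) (- \<beta>2) = 1 / pi * (LBINT \<gamma>:{- (pi / 2)<..<pi / 2}.
            (std_normal_density \<circ> Phi_inv)
              (1 - exp (- (exp (- (- x) / (- \<beta>2)) * a1 (- \<beta>2) \<gamma>))))"
      by (rule q(2))
  qed
qed

end
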